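(* Let $\{\mathcal{F}_j\}_{j=0}^p$ be a filtration and for $j=1,\ldots,p$ let $X_{0,j}$ be an $\mathcal{F}_j$-measurable and $V_j$ an $\mathcal{F}_{j-1}$-measurable real random variable. Assume that for some $m>2$ $$\mu_m:=\max_{1\le j\le p}\|V_j\|_m<\infty.$$ Suppose that for all $j$ $$\mathbb{E}(X_{0,j}\mid\mathcal{F}_{j-1})=0,\qquad \mathbb{E}(\exp[\lambda X_{0,j}]\mid\mathcal{F}_{j-1})\le\exp[\lambda^2V_j^2/2]\quad\forall\,\lambda\in\mathbb{R}.$$ Write $X_0=(X_{0,1},\ldots,X_{0,p})^T$. If all of $V_1,\ldots,V_p$ are $\mathcal{F}_0$-measurable, then for all $u\in\mathbb{R}^p$ with $\|u\|_2=1$ $$\|X_0^Tu\|_m\le\sqrt{2m}\,\mu_m.$$ For general predictable $\{V_j\}$ (i.e. $V_j$ being $\mathcal{F}_{j-1}$-measurable) we have, for $2<m_0<m$ and all $u\in\mathbb{R}^p$ with $\|u\|_2=1$, $$\|X_0^Tu\|_{m_0}\le\sqrt{\frac{2m}{m-m_0}}\left(\frac{3m\,\Gamma(m_0/2+1)}{m-m_0}\right)^{1/m_0}\mu_m.$$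
   Context: For a real random variable $Z$ and $m\ge1$, $\|Z\|_m:=(\mathbb{E}|Z|^m)^{1/m}$. For $u\in\mathbb{R}^p$, $\|u\|_2$ is the Euclidean norm. $\Gamma$ is the Gamma function. *)

theory Defs
  imports "HOL-Probability.Probability"
begin

(* The norm takes values in [0, \<infinity>], so that a bound \<open>moment_norm M m Z \<le> c\<close> includes
   finiteness of the moment; ennreal has no power function, hence the case distinction. *)

definition moment_norm :: "'a measure \<Rightarrow> real \<Rightarrow> ('a \<Rightarrow> real) \<Rightarrow> ennreal" where
  "moment_norm M m Z =
    (let I = (\<integral>\<^sup>+ x. ennreal (\<bar>Z x\<bar> powr m) \<partial>M)
     in if I = \<infinity> then \<infinity> else ennreal (enn2real I powr (1 / m)))"

definition max_moment_norm ::
    "'a measure \<Rightarrow> real \<Rightarrow> nat \<Rightarrow> (nat \<Rightarrow> 'a \<Rightarrow> real) \<Rightarrow> ennreal" where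
  "max_moment_norm M m p V = Max ((\<lambda>j. moment_norm M m (V j)) ` {1..p})"

definition filtration_upto :: "'a measure \<Rightarrow> nat \<Rightarrow> (nat \<Rightarrow> 'a measure) \<Rightarrow> bool" where
  "filtration_upto M p F \<longleftrightarrow>
    (\<forall>j\<le>p. subalgebra M (F j)) \<and> (\<forall>i j. i \<le> j \<longrightarrow> j \<le> p \<longrightarrow> subalgebra (F j) (F i))"

(* The exponential moment is conditioned with \<open>nn_cond_exp\<close>, because \<open>exp (\<lambda> X)\<close> need not be
   integrable (V j is only in L^m) and \<open>real_cond_exp\<close> returns 0 where the nonnegative
   conditional expectation is infinite. *)

definition cond_subgaussian ::
    "'a measure \<Rightarrow> 'a measure \<Rightarrow> ('a \<Rightarrow> real) \<Rightarrow> ('a \<Rightarrow> real) \<Rightarrow> bool" where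
  "cond_subgaussian M G X V \<longleftrightarrow>
    (\<forall>l::real. AE x in M.
      nn_cond_exp M G (\<lambda>y. ennreal (exp (l * X y))) x \<le> ennreal (exp (l\<^sup>2 * (V x)\<^sup>2 / 2)))"

end

(*
  Write S = sum_j u_j X_j and W^2 = sum_j u_j^2 V_j^2.  Conditioning successively on F_{p-1}, ..., F_0
  shows E[Y exp(l S - l^2 W^2 / 2)] <= E Y for F_0-measurable Y >= 0, and by convexity
  E W^m <= mu^m because the weights u_j^2 add up to 1.

  If all V_j are F_0-measurable, l may itself be chosen F_0-measurable.  With l = sqrt(m) / W
  the bound |s|^m <= (m / (e l))^m (exp(l s) + exp(-l s)) gives E|S|^m <= 2 (m / e)^(m/2) E W^m.
  As W may vanish, W^2 is replaced by W^2 + eps; the factor lost in splitting (W^2 + eps)^(m/2) is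
  absorbed because 2 exp(-m/2) <= 1.

  In general P(|S| > t) <= 2 exp(-t^2 / (2 s)) + P(W^2 > s).  Taking s = mu^2 exp(2 x / m) and
  t^2 = 2 x s makes the right-hand side 3 exp(-x), so |S| is stochastically dominated by
  mu sqrt(2 x) exp(x / m) under the measure 3 exp(-x) dx, whose moments are Gamma integrals.
*)
theory Submission
  imports Defs "HOL-Real_Asymp.Real_Asymp"
begin

section \<open>Convexity and exponential inequalities for real powers\<close>

lemma convex_on_powr_nonneg:
  fixes r :: real
  assumes "r \<ge> 1"
  shows "convex_on {0..} (\<lambda>x. x powr r)"
proof (rule convex_onI)
  fix t x y :: real
  assume t: "0 < t" "t < 1" and "x \<in> {0..}" "y \<in> {0..}"
  then have xy: "x \<ge> 0" "y \<ge> 0" by auto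
  \<comment> \<open>\<open>powr_convex\<close> is applied on the open half-line; when one argument
    is 0, the inequality reduces to s^r <= s for the weight s of the other argument.\<close>
  have le: "s powr r \<le> s" if "0 < s" "s < 1" for s :: real
    using powr_mono'[of 1 r s] that assms by simp
  have "((1 - t) * x + t * y) powr r \<le> (1 - t) * x powr r + t * y powr r"
  proof (cases "x = 0 \<or> y = 0")
    case True
    then show ?thesis
    proof
      assume "x = 0"
      with t xy show ?thesis by (simp add: powr_mult mult_right_mono le)
    next
      assume "y = 0"
      with t xy show ?thesis by (simp add: powr_mult mult_right_mono le)
    qed
  next
    case False
    with xy have "x \<in> {0<..}" "y \<in> {0<..}" by auto
    from convex_onD[OF powr_convex[OF assms] _ _ this, of t] t
    show ?thesis by simp
  qed
  then show "((1 - t) *\<^sub>R x + t *\<^sub>R y) powr r \<le> (1 - t) * x powr r + t * y powr r"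
    by simp
qed simp

text \<open>Jensen's inequality for t^(m/2), at the points v_i^2 with the weights u_i^2.\<close>

lemma powr_sum_weighted_squares_le:
  fixes u v :: "'i \<Rightarrow> real"
  assumes "finite I" "(\<Sum>i\<in>I. (u i)\<^sup>2) = 1" "m \<ge> 2"
  shows "(\<Sum>i\<in>I. (u i * v i)\<^sup>2) powr (m / 2) \<le> (\<Sum>i\<in>I. (u i)\<^sup>2 * \<bar>v i\<bar> powr m)"
proof -
  have "I \<noteq> {}" using assms(2) by auto
  have sq: "((v i)\<^sup>2) powr (m / 2) = \<bar>v i\<bar> powr m" for i
  proof -
    have "((v i)\<^sup>2) powr (m / 2) = (\<bar>v i\<bar> powr 2) powr (m / 2)" by simp
    also have "\<dots> = \<bar>v i\<bar> powr m" unfolding powr_powr by simp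
    finally show ?thesis .
  qed
  have "(\<Sum>i\<in>I. (u i)\<^sup>2 *\<^sub>R (v i)\<^sup>2) powr (m / 2) \<le> (\<Sum>i\<in>I. (u i)\<^sup>2 * ((v i)\<^sup>2) powr (m / 2))"
    by (rule convex_on_sum[OF assms(1) \<open>I \<noteq> {}\<close> convex_on_powr_nonneg]) (use assms in auto)
  then show ?thesis by (simp add: power_mult_distrib sq)
qed

text \<open>With y = l |s| / m, this is y <= exp(y - 1) raised to the power m. Adding both signs in
  the exponent replaces |s| by s, so that exponential moments of s itself control its absolute
  moments.\<close>

lemma powr_le_exp:
  fixes s l m :: real
  assumes "l > 0" "m > 0"
  shows "\<bar>s\<bar> powr m \<le> (m / l) powr m * exp (- m) * (exp (l * s) + exp (- l * s))"
proof -
  define y where "y = l * \<bar>s\<bar> / m"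
  have y: "y \<ge> 0" using assms by (simp add: y_def)
  have "y \<le> exp (y - 1)" using exp_ge_add_one_self[of "y - 1"] by simp
  then have "y powr m \<le> exp (y - 1) powr m" using y assms by (intro powr_mono2) auto
  also have "\<dots> = exp (- m) * exp (l * \<bar>s\<bar>)"
    using assms by (simp add: powr_def y_def field_simps flip: exp_add)
  also have "exp (l * \<bar>s\<bar>) \<le> exp (l * s) + exp (- l * s)"
    by (cases "s \<ge> 0") auto
  finally have *: "y powr m \<le> exp (- m) * (exp (l * s) + exp (- l * s))" by simp
  have "\<bar>s\<bar> powr m = (m / l) powr m * y powr m"
    using assms y by (simp add: y_def flip: powr_mult)
  also have "\<dots> \<le> (m / l) powr m * (exp (- m) * (exp (l * s) + exp (- l * s)))"
    by (rule mult_left_mono[OF *]) simp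
  finally show ?thesis by (simp add: mult.assoc)
qed

section \<open>Passing between moment norms and integrals of powers\<close>

lemma moment_norm_le:
  assumes "(\<integral>\<^sup>+ x. ennreal (\<bar>Z x\<bar> powr m) \<partial>M) \<le> ennreal (c powr m)" "m > 0" "c \<ge> 0"
  shows "moment_norm M m Z \<le> ennreal c"
proof -
  define I where "I = (\<integral>\<^sup>+ x. ennreal (\<bar>Z x\<bar> powr m) \<partial>M)"
  have fin: "I \<noteq> \<infinity>" using assms(1) unfolding I_def[symmetric] by (auto simp: top_unique)
  have "enn2real I \<le> c powr m"
    using assms(1) unfolding I_def[symmetric] by (intro enn2real_leI) auto
  then have "enn2real I powr (1 / m) \<le> (c powr m) powr (1 / m)"
    using assms(2) by (intro powr_mono2) auto
  also have "\<dots> = c" using assms by (simp add: powr_powr)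
  finally show ?thesis
    using fin by (simp add: moment_norm_def Let_def I_def[symmetric] ennreal_leI)
qed

lemma nn_integral_powr_le_moment_norm:
  assumes "moment_norm M m Z \<le> ennreal c" "m > 0" "c \<ge> 0"
  shows "(\<integral>\<^sup>+ x. ennreal (\<bar>Z x\<bar> powr m) \<partial>M) \<le> ennreal (c powr m)"
proof -
  define I where "I = (\<integral>\<^sup>+ x. ennreal (\<bar>Z x\<bar> powr m) \<partial>M)"
  \<comment> \<open>An infinite integral would make the norm infinite, against the real bound
    \<open>c\<close>. Only then does \<open>enn2real\<close> lose nothing.\<close>
  have fin: "I \<noteq> \<infinity>"
    using assms(1) by (auto simp: moment_norm_def Let_def I_def[symmetric] top_unique split: if_splits)
  then have "enn2real I powr (1 / m) \<le> c"
    using assms(1,3) by (simp add: moment_norm_def Let_def I_def[symmetric])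
  then have "(enn2real I powr (1 / m)) powr m \<le> c powr m"
    using assms(2) by (intro powr_mono2) auto
  then have "enn2real I \<le> c powr m"
    using assms(2) by (simp add: powr_powr)
  then show ?thesis
    using fin unfolding I_def[symmetric]
    by (metis ennreal_enn2real ennreal_leI infinity_ennreal_def top.not_eq_extremum)
qed

text \<open>The slack in c > \<mu> serves both moment bounds: it makes room for a positive
  regularisation of the variance in one, and in the other it supplies a positive constant even when
  \<mu> = 0.\<close>

lemma moment_norm_le_mult:
  assumes "\<And>c. c > \<mu> \<Longrightarrow>
      (\<integral>\<^sup>+ x. ennreal (\<bar>Z x\<bar> powr m) \<partial>M) \<le> ennreal ((K * c) powr m)"
    and "m > 0" "\<mu> \<ge> 0" "K > 0"
  shows "moment_norm M m Z \<le> ennreal K * ennreal \<mu>"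
proof (rule ennreal_le_epsilon)
  fix e :: real assume e: "0 < e"
  have "moment_norm M m Z \<le> ennreal (K * (\<mu> + e / K))"
    using e assms by (intro moment_norm_le assms(1)) auto
  also have "K * (\<mu> + e / K) = K * \<mu> + e" using assms by (simp add: field_simps)
  also have "ennreal \<dots> = ennreal K * ennreal \<mu> + ennreal e"
    using assms e by (simp add: ennreal_mult)
  finally show "moment_norm M m Z \<le> ennreal K * ennreal \<mu> + ennreal e" .
qed

section \<open>Integrals from tail bounds, and the Gamma integral\<close>

lemma (in sigma_finite_measure) nn_integral_layer_cake:
  fixes f :: "'a \<Rightarrow> real"
  assumes [measurable]: "f \<in> borel_measurable M" and nonneg: "\<And>x. x \<in> space M \<Longrightarrow> f x \<ge> 0"
  shows "(\<integral>\<^sup>+ x. ennreal (f x) \<partial>M)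
    = (\<integral>\<^sup>+ r. indicator {0..} r * emeasure M {x \<in> space M. f x > r} \<partial>lborel)"
proof -
  interpret pair_sigma_finite M lborel ..
  have "(\<integral>\<^sup>+ x. ennreal (f x) \<partial>M)
      = (\<integral>\<^sup>+ x. (\<integral>\<^sup>+ r. indicator {0..} r * indicator {y \<in> space M. f y > r} x \<partial>lborel) \<partial>M)"
  proof (intro nn_integral_cong)
    fix x assume x: "x \<in> space M"
    \<comment> \<open>The value f x is the length of [0, f x); Tonelli then exchanges the two
      integrations.\<close>
    have "ennreal (f x) = (\<integral>\<^sup>+ r. indicator {0..<f x} r \<partial>lborel)"
      using nonneg[OF x] by simp
    also have "\<dots> = (\<integral>\<^sup>+ r. indicator {0..} r * indicator {y \<in> space M. f y > r} x \<partial>lborel)"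
      using x by (intro nn_integral_cong) (auto split: split_indicator)
    finally show "ennreal (f x) = \<dots>" .
  qed
  also have "\<dots> = (\<integral>\<^sup>+ r. (\<integral>\<^sup>+ x. indicator {0..} r * indicator {y \<in> space M. f y > r} x \<partial>M) \<partial>lborel)"
    by (rule Fubini'[symmetric]) simp
  also have "\<dots> = (\<integral>\<^sup>+ r. indicator {0..} r * emeasure M {x \<in> space M. f x > r} \<partial>lborel)"
    by (intro nn_integral_cong) (simp add: nn_integral_cmult)
  finally show ?thesis .
qed

lemma nn_integral_exp_tail:
  fixes C a :: real
  assumes "C \<ge> 0"
  shows "(\<integral>\<^sup>+ x. ennreal (C * exp (- x)) * indicator {a<..} x \<partial>lborel) = ennreal (C * exp (- a))"
proof -
  have "((\<lambda>x::real. - (C * exp (- x))) \<longlongrightarrow> 0) at_top"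
    using tendsto_mult_left[OF filterlim_compose[OF exp_at_bot filterlim_uminus_at_bot_at_top], of "- C"]
    by simp
  then have "(\<integral>\<^sup>+ x. ennreal (C * exp (- x)) * indicator {a..} x \<partial>lborel)
      = ennreal (0 - - (C * exp (- a)))"
    using assms by (intro nn_integral_FTC_atLeast) (auto intro!: derivative_eq_intros)
  moreover have "(\<integral>\<^sup>+ x. ennreal (C * exp (- x)) * indicator {a<..} x \<partial>lborel)
      = (\<integral>\<^sup>+ x. ennreal (C * exp (- x)) * indicator {a..} x \<partial>lborel)"
    by (intro nn_integral_cong_AE AE_I[of _ _ "{a}"]) (auto split: split_indicator)
  ultimately show ?thesis by simp
qed

text \<open>Stochastic domination: under the measure C exp(-x) dx on the half-line, the tail of g
  beyond the level g x has mass C exp(-x), because g is strictly increasing. Thus every tail of f is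
  at most that of g, and the layer cake formula on both sides compares the integrals.\<close>

lemma (in sigma_finite_measure) nn_integral_le_exp_tail:
  fixes f :: "'a \<Rightarrow> real" and g :: "real \<Rightarrow> real"
  assumes [measurable]: "f \<in> borel_measurable M" "g \<in> borel_measurable borel"
    and f: "\<And>\<omega>. \<omega> \<in> space M \<Longrightarrow> f \<omega> \<ge> 0"
    and g: "continuous_on {0..} g" "strict_mono_on {0..} g" "g 0 = 0" "filterlim g at_top at_top"
    and C: "C \<ge> 0"
    and tail: "\<And>x. x \<ge> 0 \<Longrightarrow> emeasure M {\<omega> \<in> space M. f \<omega> > g x} \<le> ennreal (C * exp (- x))"
  shows "(\<integral>\<^sup>+ \<omega>. ennreal (f \<omega>) \<partial>M)
    \<le> (\<integral>\<^sup>+ x. ennreal (C * exp (- x)) * indicator {0..} x * ennreal (g x) \<partial>lborel)"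
proof -
  define N where "N = density lborel (\<lambda>x. ennreal (C * exp (- x)) * indicator {0..} x)"
  have [simp]: "space N = UNIV" "sets N = sets borel" by (simp_all add: N_def)
  have [measurable_cong]: "sets N = sets borel" by (simp add: N_def)
  have tail_N: "emeasure N {a<..} = ennreal (C * exp (- a))" if "a \<ge> 0" for a
  proof -
    have "emeasure N {a<..} = (\<integral>\<^sup>+ x. ennreal (C * exp (- x)) * indicator {a<..} x \<partial>lborel)"
      unfolding N_def using that
      by (subst emeasure_density) (auto intro!: nn_integral_cong split: split_indicator)
    then show ?thesis using nn_integral_exp_tail[OF C] by simp
  qed
  \<comment> \<open>The layer cake formula is also applied to N, so N has to be sigma-finite; its
    finite mass ensures this.\<close>
  have "emeasure N UNIV \<le> ennreal C"
  proof -
    have "emeasure N UNIV = (\<integral>\<^sup>+ x. ennreal (C * exp (- x)) * indicator {0<..} x \<partial>lborel)"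
      unfolding N_def
      by (subst emeasure_density)
         (auto intro!: nn_integral_cong_AE AE_I[of _ _ "{0}"] simp: indicator_def of_bool_def
          split: if_splits)
    then show ?thesis using nn_integral_exp_tail[OF C, of 0] by simp
  qed
  then interpret N: finite_measure N by (intro finite_measureI) (auto simp: top_unique)
  have g_nonneg: "g x \<ge> 0" if "x \<ge> 0" for x
    using strict_mono_onD[OF g(2), of 0 x] that g(3) by (cases "x = 0") auto
  \<comment> \<open>By the intermediate value theorem each level r >= 0 equals g a for some a >= 0,
    where the tail hypothesis applies. The truncation \<open>max 0\<close> makes g nonnegative on
    the negative axis too, a null set of N.\<close>
  have key: "emeasure M {\<omega> \<in> space M. f \<omega> > r} \<le> emeasure N {x. max 0 (g x) > r}"
    if r: "r \<ge> 0" for r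
  proof -
    obtain b where b: "b \<ge> 0" "g b \<ge> r"
      using g(4) by (metis (mono_tags, lifting) eventually_at_top_linorder filterlim_at_top linorder_linear)
    have "\<exists>a\<ge>0. a \<le> b \<and> g a = r"
      using b r g(1,3) by (intro IVT') (auto elim: continuous_on_subset)
    then obtain a where a: "a \<ge> 0" "g a = r" by auto
    have "emeasure M {\<omega> \<in> space M. f \<omega> > r} \<le> emeasure N {a<..}"
      using tail[OF a(1)] a tail_N by simp
    also have "\<dots> \<le> emeasure N {x. max 0 (g x) > r}"
    proof (rule emeasure_mono)
      show "{a<..} \<subseteq> {x. max 0 (g x) > r}"
      proof
        fix x assume "x \<in> {a<..}"
        then have "g a < g x" using strict_mono_onD[OF g(2), of a x] a by simp
        then show "x \<in> {x. max 0 (g x) > r}" using a by simp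
      qed
    qed simp
    finally show ?thesis .
  qed
  have "(\<integral>\<^sup>+ \<omega>. ennreal (f \<omega>) \<partial>M)
      = (\<integral>\<^sup>+ r. indicator {0..} r * emeasure M {\<omega> \<in> space M. f \<omega> > r} \<partial>lborel)"
    by (intro nn_integral_layer_cake f) auto
  also have "\<dots> \<le> (\<integral>\<^sup>+ r. indicator {0..} r * emeasure N {x. max 0 (g x) > r} \<partial>lborel)"
    by (intro nn_integral_mono) (auto intro: key split: split_indicator)
  also have "\<dots> = (\<integral>\<^sup>+ x. ennreal (max 0 (g x)) \<partial>N)"
    by (subst N.nn_integral_layer_cake) auto
  also have "\<dots> = (\<integral>\<^sup>+ x. ennreal (C * exp (- x)) * indicator {0..} x * ennreal (max 0 (g x)) \<partial>lborel)"
    unfolding N_def by (subst nn_integral_density) auto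
  finally show ?thesis by simp
qed

text \<open>Substituting t = b x in the Gamma integral produces the factor b^(a+1): b^a from the
  power and b from dt.\<close>

lemma nn_integral_Gamma_scaled:
  fixes a b :: real
  assumes "a > -1" "b > 0"
  shows "(\<integral>\<^sup>+ x. ennreal (x powr a * exp (- b * x)) * indicator {0..} x \<partial>lborel)
    = ennreal (Gamma (a + 1) / b powr (a + 1))"
proof -
  have "Gamma (a + 1) = (\<integral>\<^sup>+ t. ennreal (indicator {0..} t * t powr a / exp t) \<partial>lborel)"
    using Gamma_conv_nn_integral_real[of "a + 1"] assms by simp
  also have "\<dots> = ennreal b * (\<integral>\<^sup>+ x. ennreal (indicator {0..} (b * x) * (b * x) powr a / exp (b * x)) \<partial>lborel)"
    using assms nn_integral_real_affine[of "\<lambda>t. ennreal (indicator {0..} t * t powr a / exp t)" b 0]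
    by simp
  also have "\<dots> = ennreal b * (\<integral>\<^sup>+ x. ennreal (b powr a) * (ennreal (x powr a * exp (- b * x)) * indicator {0..} x) \<partial>lborel)"
    using assms
    by (intro arg_cong2[of _ _ _ _ "(*)"] refl nn_integral_cong)
       (auto simp: powr_mult exp_minus field_simps zero_le_mult_iff simp flip: ennreal_mult split: split_indicator)
  also have "\<dots> = ennreal (b powr (a + 1)) * (\<integral>\<^sup>+ x. ennreal (x powr a * exp (- b * x)) * indicator {0..} x \<partial>lborel)"
    using assms by (subst nn_integral_cmult) (auto simp: powr_add mult_ac simp flip: ennreal_mult mult.assoc)
  finally have eq: "ennreal (Gamma (a + 1)) = ennreal (b powr (a + 1)) *
      (\<integral>\<^sup>+ x. ennreal (x powr a * exp (- b * x)) * indicator {0..} x \<partial>lborel)" (is "_ = _ * ?J") .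
  have "?J = ennreal (inverse (b powr (a + 1))) * (ennreal (b powr (a + 1)) * ?J)"
    using assms by (simp flip: mult.assoc ennreal_mult)
  also have "\<dots> = ennreal (Gamma (a + 1) / b powr (a + 1))"
    using assms unfolding eq[symmetric]
    by (simp add: field_simps Gamma_real_pos less_imp_le flip: ennreal_mult)
  finally show ?thesis .
qed

section \<open>The exponential supermartingale of the weighted sum\<close>

locale subgaussian_differences = prob_space M for M :: "'a measure" +
  fixes p :: nat and F :: "nat \<Rightarrow> 'a measure" and X V :: "nat \<Rightarrow> 'a \<Rightarrow> real" and u :: "nat \<Rightarrow> real"
  assumes filtration: "filtration_upto M p F"
    and X_adapted: "\<And>j. j \<in> {1..p} \<Longrightarrow> X j \<in> borel_measurable (F j)"
    and V_predictable: "\<And>j. j \<in> {1..p} \<Longrightarrow> V j \<in> borel_measurable (F (j - 1))"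
    and subgaussian: "\<And>j. j \<in> {1..p} \<Longrightarrow> cond_subgaussian M (F (j - 1)) (X j) (V j)"
begin

definition S :: "nat \<Rightarrow> 'a \<Rightarrow> real" where
  "S k x = (\<Sum>j=1..k. X j x * u j)"

text \<open>The accumulated variance proxy of \<open>S k\<close>: conditionally on the past, u_j X_j
  is sub-Gaussian with proxy (u_j V_j)^2.\<close>

definition W2 :: "nat \<Rightarrow> 'a \<Rightarrow> real" where
  "W2 k x = (\<Sum>j=1..k. (u j * V j x)\<^sup>2)"

lemma S_simps: "S 0 x = 0" "S (Suc k) x = S k x + u (Suc k) * X (Suc k) x"
  by (simp_all add: S_def)

lemma W2_simps: "W2 0 x = 0" "W2 (Suc k) x = W2 k x + (u (Suc k) * V (Suc k) x)\<^sup>2"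
  by (simp_all add: W2_def)

lemma W2_nonneg: "W2 k x \<ge> 0"
  by (simp add: W2_def sum_nonneg)

lemma subalgebra_F: "j \<le> p \<Longrightarrow> subalgebra M (F j)"
  using filtration by (simp add: filtration_upto_def)

lemma measurable_F_mono:
  "f \<in> measurable (F i) N \<Longrightarrow> i \<le> j \<Longrightarrow> j \<le> p \<Longrightarrow> f \<in> measurable (F j) N"
  using filtration by (auto simp: filtration_upto_def intro: measurable_from_subalg)

lemma measurable_F_M: "f \<in> measurable (F j) N \<Longrightarrow> j \<le> p \<Longrightarrow> f \<in> measurable M N"
  using measurable_from_subalg[OF subalgebra_F] .

lemma X_measurable_M: "j \<in> {1..p} \<Longrightarrow> X j \<in> borel_measurable M"
  by (rule measurable_F_M[OF X_adapted]) auto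

lemma V_measurable_M: "j \<in> {1..p} \<Longrightarrow> V j \<in> borel_measurable M"
  by (rule measurable_F_M[OF V_predictable]) auto

lemma S_measurable_F: "k \<le> p \<Longrightarrow> S k \<in> borel_measurable (F k)"
  unfolding S_def[abs_def]
  by (intro borel_measurable_sum borel_measurable_times borel_measurable_const
      measurable_F_mono[OF X_adapted]) auto

lemma W2_measurable_F: "k \<le> p \<Longrightarrow> W2 k \<in> borel_measurable (F k)"
  unfolding W2_def[abs_def]
  by (intro borel_measurable_sum borel_measurable_power borel_measurable_times borel_measurable_const
      measurable_F_mono[OF V_predictable]) auto

lemma S_measurable_M [measurable]: "S p \<in> borel_measurable M"
  by (rule measurable_F_M[OF S_measurable_F]) auto

lemma W2_measurable_M [measurable]: "W2 p \<in> borel_measurable M"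
  by (rule measurable_F_M[OF W2_measurable_F]) auto

text \<open>The compensator exp(-l^2 V_j^2 / 2) is known at time j - 1, so it can be absorbed into
  the weight \<open>H'\<close>. Conditioning then replaces exp(l X_j) by its conditional
  expectation, whose bound cancels the compensator. All factors are nonnegative, so this works in
  \<open>ennreal\<close> without integrability.\<close>

lemma nn_integral_exp_difference_le:
  assumes j: "j \<in> {1..p}" and H: "H \<in> borel_measurable (F (j - 1))"
  shows "(\<integral>\<^sup>+ x. H x * ennreal (exp (l * X j x - l\<^sup>2 * (V j x)\<^sup>2 / 2)) \<partial>M) \<le> (\<integral>\<^sup>+ x. H x \<partial>M)"
proof -
  interpret G: finite_measure_subalgebra M "F (j - 1)"
    by unfold_locales (use j subalgebra_F[of "j - 1"] in auto)
  note [measurable] = H V_predictable[OF j]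
  define H' where "H' x = H x * ennreal (exp (- (l\<^sup>2 * (V j x)\<^sup>2 / 2)))" for x
  have [measurable]: "H' \<in> borel_measurable (F (j - 1))"
    unfolding H'_def by measurable
  have [measurable]: "X j \<in> borel_measurable M" by (rule X_measurable_M[OF j])
  have "(\<integral>\<^sup>+ x. H x * ennreal (exp (l * X j x - l\<^sup>2 * (V j x)\<^sup>2 / 2)) \<partial>M)
      = (\<integral>\<^sup>+ x. H' x * ennreal (exp (l * X j x)) \<partial>M)"
    by (intro nn_integral_cong)
       (simp add: H'_def mult.assoc flip: ennreal_mult exp_add)
  also have "\<dots> = (\<integral>\<^sup>+ x. H' x * nn_cond_exp M (F (j - 1)) (\<lambda>y. ennreal (exp (l * X j y))) x \<partial>M)"
    by (rule G.nn_cond_exp_intg[symmetric]) measurable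
  also have "\<dots> \<le> (\<integral>\<^sup>+ x. H' x * ennreal (exp (l\<^sup>2 * (V j x)\<^sup>2 / 2)) \<partial>M)"
  proof (rule nn_integral_mono_AE)
    have "AE x in M. nn_cond_exp M (F (j - 1)) (\<lambda>y. ennreal (exp (l * X j y))) x
        \<le> ennreal (exp (l\<^sup>2 * (V j x)\<^sup>2 / 2))"
      using subgaussian[OF j] unfolding cond_subgaussian_def by blast
    then show "AE x in M. H' x * nn_cond_exp M (F (j - 1)) (\<lambda>y. ennreal (exp (l * X j y))) x
        \<le> H' x * ennreal (exp (l\<^sup>2 * (V j x)\<^sup>2 / 2))"
      by eventually_elim (simp add: mult_left_mono)
  qed
  also have "\<dots> = (\<integral>\<^sup>+ x. H x \<partial>M)"
    by (intro nn_integral_cong) (simp add: H'_def mult.assoc flip: ennreal_mult exp_add)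
  finally show ?thesis .
qed

text \<open>Each step of the induction removes the last increment, the product of all earlier
  factors being the weight \<open>H\<close>. The factor \<open>Y\<close> is carried along so that
  the bound can be localised to events in \<open>F 0\<close>.\<close>

lemma nn_integral_exp_supermartingale:
  assumes Y: "Y \<in> borel_measurable (F 0)" and "k \<le> p"
  shows "(\<integral>\<^sup>+ x. Y x * ennreal (exp (l * S k x - l\<^sup>2 * W2 k x / 2)) \<partial>M) \<le> (\<integral>\<^sup>+ x. Y x \<partial>M)"
  using \<open>k \<le> p\<close>
proof (induction k)
  case 0
  then show ?case by (simp add: S_simps W2_simps)
next
  case (Suc k)
  define H where "H x = Y x * ennreal (exp (l * S k x - l\<^sup>2 * W2 k x / 2))" for x
  have k: "Suc k \<in> {1..p}" "k \<le> p" using Suc.prems by auto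
  note [measurable] = S_measurable_F[OF k(2)] W2_measurable_F[OF k(2)] measurable_F_mono[OF Y le0 k(2)]
  have H: "H \<in> borel_measurable (F (Suc k - 1))"
    unfolding H_def diff_Suc_1 by measurable
  \<comment> \<open>The last increment has the form of \<open>nn_integral_exp_difference_le\<close>
    with l u_(k+1) in place of l.\<close>
  have "(\<integral>\<^sup>+ x. Y x * ennreal (exp (l * S (Suc k) x - l\<^sup>2 * W2 (Suc k) x / 2)) \<partial>M)
      = (\<integral>\<^sup>+ x. H x * ennreal (exp (l * u (Suc k) * X (Suc k) x
          - (l * u (Suc k))\<^sup>2 * (V (Suc k) x)\<^sup>2 / 2)) \<partial>M)"
    by (intro nn_integral_cong)
       (simp add: H_def S_simps W2_simps mult.assoc algebra_simps power_mult_distrib add_divide_distrib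
          flip: ennreal_mult exp_add)
  also have "\<dots> \<le> (\<integral>\<^sup>+ x. H x \<partial>M)"
    by (rule nn_integral_exp_difference_le[OF k(1) H])
  also have "\<dots> \<le> (\<integral>\<^sup>+ x. Y x \<partial>M)"
    unfolding H_def using Suc.IH k(2) .
  finally show ?case .
qed

text \<open>The exceptional null set in \<open>cond_subgaussian\<close> depends on l, so a random
  parameter cannot simply be substituted. A simple function is constant on each of finitely many
  events in \<open>F 0\<close>, where the bound for fixed l applies with \<open>Y\<close> restricted
  to the event; Fatou's lemma passes to the limit.\<close>

lemma nn_integral_exp_supermartingale_random:
  fixes L :: "'a \<Rightarrow> real"
  assumes Y: "Y \<in> borel_measurable (F 0)" and L: "L \<in> borel_measurable (F 0)"
  shows "(\<integral>\<^sup>+ x. Y x * ennreal (exp (L x * S p x - (L x)\<^sup>2 * W2 p x / 2)) \<partial>M) \<le> (\<integral>\<^sup>+ x. Y x \<partial>M)"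
proof -
  have space: "space (F 0) = space M" using subalgebra_F[of 0] by (simp add: subalgebra_def)
  have Y_M [measurable]: "Y \<in> borel_measurable M" by (rule measurable_F_M[OF Y]) simp
  define Z where "Z l x = Y x * ennreal (exp (l * S p x - l\<^sup>2 * W2 p x / 2))" for l x
  obtain s where s: "\<And>i. simple_function (F 0) (s i)"
    "\<And>x. x \<in> space M \<Longrightarrow> (\<lambda>i. s i x) \<longlonglongrightarrow> L x"
    using borel_measurable_implies_sequence_metric[OF L, of 0] space by metis
  have s_M [measurable]: "s i \<in> borel_measurable M" for i
    by (rule measurable_F_M[OF borel_measurable_simple_function[OF s(1)]]) simp
  have simple: "(\<integral>\<^sup>+ x. Z (s i x) x \<partial>M) \<le> (\<integral>\<^sup>+ x. Y x \<partial>M)" for i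
  proof -
    define R where "R = s i ` space M"
    have fin: "finite R" using simple_functionD(1)[OF s(1)] by (simp add: R_def space)
    define A where "A l = s i -` {l} \<inter> space M" for l
    have A: "A l \<in> sets (F 0)" for l
      using simple_functionD(2)[OF s(1)[of i], of "{l}"] by (simp add: A_def space)
    then have A_M [measurable]: "A l \<in> sets M" for l
      using subalgebra_F[of 0] by (auto simp: subalgebra_def)
    have sum_ind: "h (s i x) = (\<Sum>l\<in>R. h l * indicator (A l) x)"
      if "x \<in> space M" for x and h :: "real \<Rightarrow> ennreal"
    proof -
      have "(\<Sum>l\<in>R. h l * indicator (A l) x) = (\<Sum>l\<in>R. if l = s i x then h l else 0)"
        using that by (intro sum.cong) (auto simp: A_def indicator_def)
      then show ?thesis using that fin by (simp add: R_def)
    qed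
    have "(\<integral>\<^sup>+ x. Z (s i x) x \<partial>M) = (\<integral>\<^sup>+ x. (\<Sum>l\<in>R. Z l x * indicator (A l) x) \<partial>M)"
      by (intro nn_integral_cong) (simp add: sum_ind[of _ "\<lambda>l. Z l _"])
    also have "\<dots> = (\<Sum>l\<in>R. \<integral>\<^sup>+ x. Z l x * indicator (A l) x \<partial>M)"
      unfolding Z_def by (rule nn_integral_sum) measurable
    also have "\<dots> \<le> (\<Sum>l\<in>R. \<integral>\<^sup>+ x. Y x * indicator (A l) x \<partial>M)"
    proof (rule sum_mono)
      fix l
      have "(\<lambda>x. Y x * indicator (A l) x) \<in> borel_measurable (F 0)"
        using Y A by measurable
      from nn_integral_exp_supermartingale[OF this, of p l]
      show "(\<integral>\<^sup>+ x. Z l x * indicator (A l) x \<partial>M) \<le> (\<integral>\<^sup>+ x. Y x * indicator (A l) x \<partial>M)"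
        by (simp add: Z_def mult_ac)
    qed
    also have "\<dots> = (\<integral>\<^sup>+ x. (\<Sum>l\<in>R. Y x * indicator (A l) x) \<partial>M)"
      by (rule nn_integral_sum[symmetric]) measurable
    also have "\<dots> = (\<integral>\<^sup>+ x. Y x \<partial>M)"
      by (intro nn_integral_cong) (simp add: sum_ind[of _ "\<lambda>l. Y _", symmetric])
    finally show ?thesis .
  qed
  \<comment> \<open>The exponential is continuous in its parameter, so the integrands converge
    pointwise and the limit may be written as a \<open>liminf\<close>.\<close>
  have "(\<integral>\<^sup>+ x. Z (L x) x \<partial>M) = (\<integral>\<^sup>+ x. liminf (\<lambda>i. Z (s i x) x) \<partial>M)"
  proof (intro nn_integral_cong)
    fix x assume "x \<in> space M"
    from s(2)[OF this] have "(\<lambda>i. Z (s i x) x) \<longlonglongrightarrow> Z (L x) x"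
      unfolding Z_def by (intro ennreal_tendsto_cmult tendsto_ennrealI tendsto_intros) auto
    then show "Z (L x) x = liminf (\<lambda>i. Z (s i x) x)"
      by (simp add: lim_imp_Liminf)
  qed
  also have "\<dots> \<le> liminf (\<lambda>i. \<integral>\<^sup>+ x. Z (s i x) x \<partial>M)"
    unfolding Z_def by (rule nn_integral_liminf) measurable
  also have "\<dots> \<le> liminf (\<lambda>i::nat. \<integral>\<^sup>+ x. Y x \<partial>M)"
    using simple by (intro Liminf_mono) auto
  finally show ?thesis by (simp add: Z_def Liminf_const)
qed

section \<open>Moments when the variance proxy is known at time 0\<close>

lemma nn_integral_S_powr_le:
  fixes m e :: real
  assumes W2_F0: "W2 p \<in> borel_measurable (F 0)" and m: "m \<ge> 2" and e: "e > 0"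
  shows "(\<integral>\<^sup>+ x. ennreal (\<bar>S p x\<bar> powr m) \<partial>M)
    \<le> ennreal ((2 * m) powr (m / 2)) *
        ((\<integral>\<^sup>+ x. ennreal (W2 p x powr (m / 2)) \<partial>M) + ennreal (e powr (m / 2)))"
proof -
  define D where "D x = W2 p x + e" for x
  have D: "D x > 0" for x using W2_nonneg[of p x] e by (simp add: D_def)
  \<comment> \<open>This l minimises (m / l)^m exp(l^2 D / 2), the quantity obtained from
    \<open>powr_le_exp\<close> after compensating with variance D.\<close>
  define L where "L x = sqrt (m / D x)" for x
  have L: "L x > 0" "(L x)\<^sup>2 = m / D x" for x using D[of x] m by (simp_all add: L_def)
  define K where "K = m powr (m / 2) * exp (- (m / 2))"
  have K: "K \<ge> 0" by (simp add: K_def)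
  define Z where "Z l x = exp (l * S p x - l\<^sup>2 * W2 p x / 2)" for l x
  note [measurable] = W2_F0
  have D_F [measurable]: "D \<in> borel_measurable (F 0)" and L_F [measurable]: "L \<in> borel_measurable (F 0)"
    unfolding D_def L_def by measurable
  have [measurable]: "D \<in> borel_measurable M" "L \<in> borel_measurable M"
    using D_F L_F measurable_F_M by blast+
  have pointwise: "\<bar>S p x\<bar> powr m \<le> K * (D x powr (m / 2) * (Z (L x) x + Z (- L x) x))" for x
  proof -
    have sq: "(m / L x)\<^sup>2 = m * D x" using D[of x] m L[of x] by (simp add: power_divide power2_eq_square)
    have "(m / L x) powr m = ((m / L x) powr 2) powr (m / 2)" unfolding powr_powr by simp
    also have "\<dots> = m powr (m / 2) * D x powr (m / 2)"
      using sq m L(1)[of x] D[of x] by (simp add: powr_mult)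
    finally have base: "(m / L x) powr m = m powr (m / 2) * D x powr (m / 2)" .
    \<comment> \<open>Since W2 <= D, the exponent L^2 W2 / 2 is at most m / 2, so inserting the
      compensator costs at most exp(m / 2).\<close>
    have "m / D x * W2 p x \<le> m" using D[of x] m e by (simp add: D_def field_simps)
    then have le: "exp (l * S p x) \<le> exp (m / 2) * Z l x" if "l\<^sup>2 = (L x)\<^sup>2" for l
      unfolding Z_def that L(2) by (simp flip: exp_add)
    have "\<bar>S p x\<bar> powr m \<le> (m / L x) powr m * exp (- m) * (exp (L x * S p x) + exp (- L x * S p x))"
      using L(1) m by (intro powr_le_exp) auto
    also have "\<dots> \<le> (m / L x) powr m * exp (- m) * (exp (m / 2) * Z (L x) x + exp (m / 2) * Z (- L x) x)"
      by (intro mult_left_mono add_mono le) auto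
    also have "\<dots> = K * (D x powr (m / 2) * (Z (L x) x + Z (- L x) x))"
    proof -
      have "exp (- (m / 2)) = exp (- m) * exp (m / 2)" by (simp flip: exp_add)
      then show ?thesis unfolding base K_def by (simp only: algebra_simps)
    qed
    finally show ?thesis .
  qed
  have "(\<integral>\<^sup>+ x. ennreal (\<bar>S p x\<bar> powr m) \<partial>M)
      \<le> (\<integral>\<^sup>+ x. ennreal K * (ennreal (D x powr (m / 2)) * ennreal (Z (L x) x)
            + ennreal (D x powr (m / 2)) * ennreal (Z (- L x) x)) \<partial>M)"
  proof (rule nn_integral_mono)
    fix x
    have "ennreal (\<bar>S p x\<bar> powr m) \<le> ennreal (K * (D x powr (m / 2) * (Z (L x) x + Z (- L x) x)))"
      by (rule ennreal_leI[OF pointwise])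
    also have "\<dots> = ennreal K * (ennreal (D x powr (m / 2)) * ennreal (Z (L x) x)
        + ennreal (D x powr (m / 2)) * ennreal (Z (- L x) x))"
      using K by (simp add: Z_def ennreal_mult distrib_left)
    finally show "ennreal (\<bar>S p x\<bar> powr m) \<le> \<dots>" .
  qed
  also have "\<dots> = ennreal K * ((\<integral>\<^sup>+ x. ennreal (D x powr (m / 2)) * ennreal (Z (L x) x) \<partial>M)
      + (\<integral>\<^sup>+ x. ennreal (D x powr (m / 2)) * ennreal (Z (- L x) x) \<partial>M))"
    unfolding Z_def by (simp add: nn_integral_cmult nn_integral_add)
  \<comment> \<open>The supermartingale bound is used for the parameters L and -L, with the weight
    D^(m/2); all three are measurable with respect to \<open>F 0\<close>.\<close>
  also have "\<dots> \<le> ennreal K * ((\<integral>\<^sup>+ x. ennreal (D x powr (m / 2)) \<partial>M) + (\<integral>\<^sup>+ x. ennreal (D x powr (m / 2)) \<partial>M))"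
    unfolding Z_def by (intro mult_left_mono add_mono nn_integral_exp_supermartingale_random) auto
  also have "\<dots> = ennreal (2 * K) * (\<integral>\<^sup>+ x. ennreal (D x powr (m / 2)) \<partial>M)"
    using K by (simp add: ennreal_mult mult_2 mult_ac flip: mult_2)
  also have "\<dots> \<le> ennreal (2 * K) * (\<integral>\<^sup>+ x. ennreal (2 powr (m / 2)) *
      (ennreal (W2 p x powr (m / 2)) + ennreal (e powr (m / 2))) \<partial>M)"
  proof (intro mult_left_mono nn_integral_mono)
    fix x
    have "D x powr (m / 2) \<le> (2 * max (W2 p x) e) powr (m / 2)"
      using D[of x] m by (intro powr_mono2) (auto simp: D_def)
    also have "\<dots> = 2 powr (m / 2) * max (W2 p x) e powr (m / 2)"
      using e by (simp add: powr_mult)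
    also have "max (W2 p x) e powr (m / 2) \<le> W2 p x powr (m / 2) + e powr (m / 2)"
      by (simp add: max_def)
    finally show "ennreal (D x powr (m / 2)) \<le> ennreal (2 powr (m / 2)) *
      (ennreal (W2 p x powr (m / 2)) + ennreal (e powr (m / 2)))"
      by (simp flip: ennreal_plus ennreal_mult add: ennreal_leI)
  qed auto
  also have "\<dots> = ennreal (2 * K * 2 powr (m / 2)) *
      ((\<integral>\<^sup>+ x. ennreal (W2 p x powr (m / 2)) \<partial>M) + ennreal (e powr (m / 2)))"
    using K by (simp add: nn_integral_cmult nn_integral_add emeasure_space_1 ennreal_mult mult.assoc)
  also have "\<dots> \<le> ennreal ((2 * m) powr (m / 2)) *
      ((\<integral>\<^sup>+ x. ennreal (W2 p x powr (m / 2)) \<partial>M) + ennreal (e powr (m / 2)))"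
  proof (intro mult_right_mono ennreal_leI)
    \<comment> \<open>The factor exp(-m/2) left in \<open>K\<close> pays for the 2 that came from
      the two signs; 2^(m/2) joins m^(m/2) and is the source of the 2 in sqrt(2 m).\<close>
    have "2 \<le> exp (m / 2)" using exp_ge_add_one_self[of "m / 2"] m by linarith
    then have "2 * exp (- (m / 2)) \<le> 1" by (simp add: exp_minus field_simps)
    from mult_right_mono[OF this, of "m powr (m / 2) * 2 powr (m / 2)"]
    show "2 * K * 2 powr (m / 2) \<le> (2 * m) powr (m / 2)"
      using m by (simp add: K_def powr_mult mult_ac)
  qed auto
  finally show ?thesis .
qed

section \<open>Tails and moments for a predictable variance proxy\<close>

lemma emeasure_S_tail:
  fixes s t :: real
  assumes s: "s > 0" and t: "t \<ge> 0"
  shows "emeasure M {x \<in> space M. \<bar>S p x\<bar> > t}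
    \<le> ennreal (2 * exp (- (t\<^sup>2 / (2 * s)))) + emeasure M {x \<in> space M. W2 p x > s}"
proof -
  define q where "q = exp (- (t\<^sup>2 / (2 * s)))"
  define Z where "Z l x = exp (l * S p x - l\<^sup>2 * W2 p x / 2)" for l x
  \<comment> \<open>Chernoff's argument: \<open>A l\<close> is the event that the supermartingale
    reaches 1/q = exp(t^2 / (2 s)), and Markov's inequality gives it probability at most q. The
    parameters used are l = t/s and l = -t/s, since t/s maximises l t - l^2 s / 2 with value t^2 /
    (2 s). Where W2 <= s, the sign of S decides which of the two events contains a point with |S| >
    t.\<close>
  define A where "A l = {x \<in> space M. 1 \<le> ennreal q * ennreal (Z l x)}" for l
  have [measurable]: "A l \<in> sets M" for l unfolding A_def Z_def by measurable
  have A: "emeasure M (A l) \<le> ennreal q" for l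
  proof -
    have "emeasure M (A l) \<le> ennreal q * (\<integral>\<^sup>+ x. ennreal (Z l x) * indicator (space M) x \<partial>M)"
      unfolding A_def Z_def by (rule nn_integral_Markov_inequality) auto
    also have "(\<integral>\<^sup>+ x. ennreal (Z l x) * indicator (space M) x \<partial>M) = (\<integral>\<^sup>+ x. 1 * ennreal (Z l x) \<partial>M)"
      by (intro nn_integral_cong) simp
    also have "\<dots> \<le> (\<integral>\<^sup>+ x. 1 \<partial>M)"
      unfolding Z_def by (rule nn_integral_exp_supermartingale) auto
    finally show ?thesis by (simp add: emeasure_space_1 mult_left_mono)
  qed
  have "{x \<in> space M. \<bar>S p x\<bar> > t}
      \<subseteq> (A (t / s) \<union> A (- (t / s))) \<union> {x \<in> space M. W2 p x > s}"
  proof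
    fix x assume x: "x \<in> {x \<in> space M. \<bar>S p x\<bar> > t}"
    have "x \<in> A l" if l: "l * S p x \<ge> t\<^sup>2 / s" "l\<^sup>2 = (t / s)\<^sup>2" and W: "W2 p x \<le> s" for l
    proof -
      have "l\<^sup>2 * W2 p x \<le> (t / s)\<^sup>2 * s" unfolding l(2) by (intro mult_left_mono W) auto
      also have "\<dots> = t\<^sup>2 / s" using s by (simp add: power2_eq_square)
      finally have "1 \<le> q * Z l x"
        using l(1) by (simp add: q_def Z_def field_simps flip: exp_add)
      then show ?thesis using x by (simp add: A_def q_def Z_def flip: ennreal_mult)
    qed
    moreover have "t / s * \<bar>S p x\<bar> \<ge> t\<^sup>2 / s"
      using x s t mult_left_mono[of t "\<bar>S p x\<bar>" "t / s"] by (simp add: power2_eq_square)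
    ultimately show "x \<in> (A (t / s) \<union> A (- (t / s))) \<union> {x \<in> space M. W2 p x > s}"
      using x by (cases "S p x \<ge> 0"; cases "W2 p x \<le> s") auto
  qed
  then have "emeasure M {x \<in> space M. \<bar>S p x\<bar> > t}
      \<le> emeasure M ((A (t / s) \<union> A (- (t / s))) \<union> {x \<in> space M. W2 p x > s})"
    by (rule emeasure_mono) measurable
  also have "\<dots> \<le> (emeasure M (A (t / s)) + emeasure M (A (- (t / s)))) + emeasure M {x \<in> space M. W2 p x > s}"
    by (intro order_trans[OF emeasure_subadditive] add_mono) auto
  also have "\<dots> \<le> (ennreal q + ennreal q) + emeasure M {x \<in> space M. W2 p x > s}"
    by (intro add_mono A order_refl)
  finally show ?thesis by (simp add: q_def flip: ennreal_plus)
qed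

text \<open>The level s solves s^(m/2) = c^m exp(x), so Markov's inequality for W2^(m/2) bounds the
  probability of W2 > s by exp(-x). The level t is then matched so that each of the two Chernoff
  terms is exp(-x) as well.\<close>

lemma emeasure_S_exp_tail:
  fixes c m x :: real
  assumes W2: "(\<integral>\<^sup>+ x. ennreal (W2 p x powr (m / 2)) \<partial>M) \<le> ennreal (c powr m)"
    and c: "c > 0" and m: "m > 0" and x: "x \<ge> 0"
  shows "emeasure M {\<omega> \<in> space M. \<bar>S p \<omega>\<bar> > c * sqrt (2 * x) * exp (x / m)} \<le> ennreal (3 * exp (- x))"
proof -
  define s where "s = (c * exp (x / m))\<^sup>2"
  define t where "t = c * sqrt (2 * x) * exp (x / m)"
  have s: "s > 0" and t: "t \<ge> 0" using c x by (simp_all add: s_def t_def)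
  have t2: "t\<^sup>2 / (2 * s) = x" using c x by (simp add: s_def t_def power_mult_distrib)
  have "s powr (m / 2) = ((c * exp (x / m)) powr 2) powr (m / 2)" using c by (simp add: s_def)
  also have "\<dots> = (c * exp (x / m)) powr m" unfolding powr_powr by simp
  also have "\<dots> = c powr m * exp x" using c m by (simp add: powr_mult) (simp add: powr_def)
  finally have sm: "s powr (m / 2) = c powr m * exp x" .
  have "emeasure M {\<omega> \<in> space M. W2 p \<omega> > s}
      \<le> emeasure M {\<omega> \<in> space M. 1 \<le> ennreal (1 / s powr (m / 2)) * ennreal (W2 p \<omega> powr (m / 2))}"
  proof (rule emeasure_mono)
    show "{\<omega> \<in> space M. W2 p \<omega> > s}
        \<subseteq> {\<omega> \<in> space M. 1 \<le> ennreal (1 / s powr (m / 2)) * ennreal (W2 p \<omega> powr (m / 2))}"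
    proof safe
      fix \<omega> assume "W2 p \<omega> > s"
      then have "s powr (m / 2) \<le> W2 p \<omega> powr (m / 2)" using s m by (intro powr_mono2) auto
      then show "1 \<le> ennreal (1 / s powr (m / 2)) * ennreal (W2 p \<omega> powr (m / 2))"
        using s by (simp add: field_simps flip: ennreal_mult)
    qed
  qed measurable
  also have "\<dots> \<le> ennreal (1 / s powr (m / 2)) * (\<integral>\<^sup>+ \<omega>. ennreal (W2 p \<omega> powr (m / 2)) * indicator (space M) \<omega> \<partial>M)"
    by (rule nn_integral_Markov_inequality) auto
  also have "(\<integral>\<^sup>+ \<omega>. ennreal (W2 p \<omega> powr (m / 2)) * indicator (space M) \<omega> \<partial>M)
      = (\<integral>\<^sup>+ \<omega>. ennreal (W2 p \<omega> powr (m / 2)) \<partial>M)"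
    by (intro nn_integral_cong) simp
  also have "ennreal (1 / s powr (m / 2)) * \<dots> \<le> ennreal (1 / s powr (m / 2)) * ennreal (c powr m)"
    by (rule mult_left_mono[OF W2]) simp
  also have "\<dots> = ennreal (exp (- x))"
    using c by (simp add: sm exp_minus field_simps flip: ennreal_mult)
  finally have W: "emeasure M {\<omega> \<in> space M. W2 p \<omega> > s} \<le> ennreal (exp (- x))" .
  have "emeasure M {\<omega> \<in> space M. \<bar>S p \<omega>\<bar> > t} \<le> ennreal (2 * exp (- x)) + ennreal (exp (- x))"
    using emeasure_S_tail[OF s t] W unfolding t2 by (meson add_left_mono order_trans)
  then show ?thesis by (simp add: t_def flip: ennreal_plus)
qed

lemma nn_integral_S_powr_le_predictable:
  fixes c m n :: real
  assumes W2: "(\<integral>\<^sup>+ x. ennreal (W2 p x powr (m / 2)) \<partial>M) \<le> ennreal (c powr m)"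
    and c: "c > 0" and n: "n > 0" "n < m"
  shows "(\<integral>\<^sup>+ x. ennreal (\<bar>S p x\<bar> powr n) \<partial>M)
    \<le> ennreal ((sqrt (2 * m / (m - n)) * (3 * m * Gamma (n / 2 + 1) / (m - n)) powr (1 / n) * c) powr n)"
proof -
  define h where "h x = c * sqrt (2 * x) * exp (x / m)" for x
  \<comment> \<open>Here b = 1 - n/m is the rate of decay left when the growth exp(n x / m) of h^n
    meets exp(-x); it is positive because n < m.\<close>
  define b where "b = (m - n) / m"
  have b: "b > 0" using n by (simp add: b_def)
  have h0: "h x \<ge> 0" if "x \<ge> 0" for x using that c by (simp add: h_def)
  have h_mono: "h x < h y" if "0 \<le> x" "x < y" for x y
    unfolding h_def using that c n by (intro mult_strict_mono'[of "c * _"]) (auto simp: divide_strict_right_mono)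
  have h_lim: "filterlim h at_top at_top"
  proof (rule filterlim_at_top_mono)
    show "filterlim (\<lambda>x. c * sqrt x) at_top at_top"
      using c by (intro filterlim_tendsto_pos_mult_at_top[OF tendsto_const] sqrt_at_top) auto
    show "\<forall>\<^sub>F x in at_top. c * sqrt x \<le> h x"
      using eventually_ge_at_top[of 0]
    proof eventually_elim
      case (elim x)
      have "c * sqrt x * 1 \<le> c * sqrt (2 * x) * exp (x / m)"
        using elim c n by (intro mult_mono mult_left_mono) auto
      then show ?case by (simp add: h_def)
    qed
  qed
  \<comment> \<open>Domination is applied to |S|^n and h^n, the n-th power preserving the order of
    nonnegative numbers.\<close>
  have "(\<integral>\<^sup>+ x. ennreal (\<bar>S p x\<bar> powr n) \<partial>M)
      \<le> (\<integral>\<^sup>+ x. ennreal (3 * exp (- x)) * indicator {0..} x * ennreal (h x powr n) \<partial>lborel)"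
  proof (rule nn_integral_le_exp_tail)
    show "(\<lambda>x. h x powr n) \<in> borel_measurable borel"
      unfolding h_def by measurable
    show "continuous_on {0..} (\<lambda>x. h x powr n)"
      unfolding h_def using n c by (intro continuous_on_powr' continuous_intros) auto
    show "strict_mono_on {0..} (\<lambda>x. h x powr n)"
      using h_mono h0 n by (intro strict_mono_onI powr_less_mono2) auto
    show "h 0 powr n = 0" by (simp add: h_def)
    show "filterlim (\<lambda>x. h x powr n) at_top at_top"
      using n by (intro filterlim_compose[OF real_powr_at_top h_lim])
    show "emeasure M {\<omega> \<in> space M. h x powr n < \<bar>S p \<omega>\<bar> powr n} \<le> ennreal (3 * exp (- x))"
      if x: "x \<ge> 0" for x
    proof -
      have "h x powr n < \<bar>S p \<omega>\<bar> powr n \<longleftrightarrow> h x < \<bar>S p \<omega>\<bar>" for \<omega>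
        using h0[OF x] n powr_less_mono2[of n "h x" "\<bar>S p \<omega>\<bar>"] powr_mono2[of n "\<bar>S p \<omega>\<bar>" "h x"]
        by linarith
      then show ?thesis
        using emeasure_S_exp_tail[OF W2 c _ x] n by (simp add: h_def)
    qed
  qed auto
  also have "\<dots> = (\<integral>\<^sup>+ x. ennreal (3 * c powr n * 2 powr (n / 2)) *
      (ennreal (x powr (n / 2) * exp (- b * x)) * indicator {0..} x) \<partial>lborel)"
  proof (intro nn_integral_cong)
    fix x :: real
    show "ennreal (3 * exp (- x)) * indicator {0..} x * ennreal (h x powr n)
      = ennreal (3 * c powr n * 2 powr (n / 2)) * (ennreal (x powr (n / 2) * exp (- b * x)) * indicator {0..} x)"
    proof (cases "x \<ge> 0")
      case True
      have "h x powr n = c powr n * sqrt (2 * x) powr n * exp (x / m) powr n"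
        using True c by (simp add: h_def powr_mult)
      also have "sqrt (2 * x) powr n = 2 powr (n / 2) * x powr (n / 2)"
        using True by (simp add: powr_mult powr_powr flip: powr_half_sqrt)
      also have "exp (x / m) powr n = exp (n * x / m)" by (simp add: powr_def)
      finally have "3 * exp (- x) * h x powr n
          = 3 * c powr n * 2 powr (n / 2) * (x powr (n / 2) * (exp (- x) * exp (n * x / m)))"
        by simp
      also have "exp (- x) * exp (n * x / m) = exp (- b * x)"
        using n by (simp add: b_def field_simps flip: exp_add)
      finally show ?thesis using True by (simp flip: ennreal_mult)
    qed simp
  qed
  also have "\<dots> = ennreal (3 * c powr n * 2 powr (n / 2)) * ennreal (Gamma (n / 2 + 1) / b powr (n / 2 + 1))"
    using n b by (subst nn_integral_cmult) (auto simp: nn_integral_Gamma_scaled[of "n / 2" b, simplified])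
  also have "\<dots> = ennreal (3 * c powr n * 2 powr (n / 2) * (Gamma (n / 2 + 1) / b powr (n / 2 + 1)))"
    using n by (intro ennreal_mult[symmetric]) (auto intro!: divide_nonneg_nonneg Gamma_real_nonneg)
  \<comment> \<open>Of the power b^(n/2 + 1), the part b^(n/2) goes into sqrt(2 / b)^n and the
    remaining b stays under 3 Gamma(n/2 + 1). Finally 1 / b = m / (m - n).\<close>
  also have "3 * c powr n * 2 powr (n / 2) * (Gamma (n / 2 + 1) / b powr (n / 2 + 1))
    = (sqrt (2 / b) * (3 * Gamma (n / 2 + 1) / b) powr (1 / n) * c) powr n"
  proof -
    have G: "Gamma (n / 2 + 1) > 0" using n by (intro Gamma_real_pos) auto
    have "(sqrt (2 / b) * (3 * Gamma (n / 2 + 1) / b) powr (1 / n) * c) powr n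
        = sqrt (2 / b) powr n * (3 * Gamma (n / 2 + 1) / b) * c powr n"
      using b c G n by (simp add: powr_mult powr_powr)
    also have "sqrt (2 / b) powr n = 2 powr (n / 2) / b powr (n / 2)"
      using b by (simp add: powr_powr powr_divide flip: powr_half_sqrt)
    finally show ?thesis using b by (simp add: powr_add)
  qed
  finally show ?thesis using n by (simp add: b_def mult_ac)
qed

text \<open>The pointwise Jensen bound is integrated term by term. The normalisation of
  \<open>u\<close> enters here: the weights u_j^2 sum to 1, so the common bound \<open>C\<close>
  survives unchanged.\<close>

lemma nn_integral_W2_powr_le:
  assumes "L2_set u {1..p} = 1" "m \<ge> 2"
    and V: "\<And>j. j \<in> {1..p} \<Longrightarrow> (\<integral>\<^sup>+ x. ennreal (\<bar>V j x\<bar> powr m) \<partial>M) \<le> ennreal C"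
    and C: "C \<ge> 0"
  shows "(\<integral>\<^sup>+ x. ennreal (W2 p x powr (m / 2)) \<partial>M) \<le> ennreal C"
proof -
  have u: "(\<Sum>j=1..p. (u j)\<^sup>2) = 1" using assms(1) by (simp add: L2_set_def)
  note [measurable] = V_measurable_M
  have "(\<integral>\<^sup>+ x. ennreal (W2 p x powr (m / 2)) \<partial>M)
      \<le> (\<integral>\<^sup>+ x. (\<Sum>j=1..p. ennreal ((u j)\<^sup>2) * ennreal (\<bar>V j x\<bar> powr m)) \<partial>M)"
    using powr_sum_weighted_squares_le[OF _ u assms(2)]
    by (intro nn_integral_mono) (simp add: W2_def ennreal_leI flip: ennreal_mult)
  also have "\<dots> = (\<Sum>j=1..p. \<integral>\<^sup>+ x. ennreal ((u j)\<^sup>2) * ennreal (\<bar>V j x\<bar> powr m) \<partial>M)"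
    by (rule nn_integral_sum) measurable
  also have "\<dots> = (\<Sum>j=1..p. ennreal ((u j)\<^sup>2) * (\<integral>\<^sup>+ x. ennreal (\<bar>V j x\<bar> powr m) \<partial>M))"
    by (intro sum.cong refl nn_integral_cmult) measurable
  also have "\<dots> \<le> (\<Sum>j=1..p. ennreal ((u j)\<^sup>2) * ennreal C)"
    by (intro sum_mono mult_left_mono V) auto
  also have "\<dots> = ennreal C"
    using C u by (simp flip: ennreal_mult sum_distrib_right)
  finally show ?thesis .
qed

end

section \<open>From the integral estimates to the two norm bounds\<close>

theorem lemma8p2:
  fixes M :: "'a measure" and p :: nat and F :: "nat \<Rightarrow> 'a measure"
    and X V :: "nat \<Rightarrow> 'a \<Rightarrow> real" and m :: real
  assumes "prob_space M"
    and "filtration_upto M p F"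
    and "\<And>j. j \<in> {1..p} \<Longrightarrow> X j \<in> borel_measurable (F j)"
    and "\<And>j. j \<in> {1..p} \<Longrightarrow> V j \<in> borel_measurable (F (j - 1))"
    and "m > 2"
    and "max_moment_norm M m p V < \<infinity>"
    and "\<And>j. j \<in> {1..p} \<Longrightarrow> AE x in M. real_cond_exp M (F (j - 1)) (X j) x = 0"
    and "\<And>j. j \<in> {1..p} \<Longrightarrow> cond_subgaussian M (F (j - 1)) (X j) (V j)"
  shows "((\<forall>j\<in>{1..p}. V j \<in> borel_measurable (F 0)) \<longrightarrow>
            (\<forall>u::nat \<Rightarrow> real. L2_set u {1..p} = 1 \<longrightarrow>
              moment_norm M m (\<lambda>x. \<Sum>j=1..p. X j x * u j)
                \<le> ennreal (sqrt (2 * m)) * max_moment_norm M m p V)) \<and>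
         (\<forall>m\<^sub>0::real. 2 < m\<^sub>0 \<and> m\<^sub>0 < m \<longrightarrow>
            (\<forall>u::nat \<Rightarrow> real. L2_set u {1..p} = 1 \<longrightarrow>
              moment_norm M m\<^sub>0 (\<lambda>x. \<Sum>j=1..p. X j x * u j)
                \<le> ennreal (sqrt (2 * m / (m - m\<^sub>0)) *
                    (3 * m * Gamma (m\<^sub>0 / 2 + 1) / (m - m\<^sub>0)) powr (1 / m\<^sub>0))
                  * max_moment_norm M m p V))"
proof -
  \<comment> \<open>For p = 0 the maximum is over an empty set, which is harmless: the sum of
    squares is then empty and no \<open>u\<close> has norm 1.\<close>
  define \<mu> where "\<mu> = enn2real (max_moment_norm M m p V)"
  have \<mu>: "\<mu> \<ge> 0" "max_moment_norm M m p V = ennreal \<mu>"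
    using assms(6) by (simp_all add: \<mu>_def less_top)
  have V: "(\<integral>\<^sup>+ x. ennreal (\<bar>V j x\<bar> powr m) \<partial>M) \<le> ennreal (\<mu> powr m)" if "j \<in> {1..p}" for j
  proof (rule nn_integral_powr_le_moment_norm)
    show "moment_norm M m (V j) \<le> ennreal \<mu>"
      unfolding \<mu>(2)[symmetric] max_moment_norm_def using that by (intro Max_ge) auto
  qed (use assms(5) \<mu> in auto)
  have diffs: "subgaussian_differences M p F X V"
    using assms by (simp add: subgaussian_differences_def subgaussian_differences_axioms_def)
  have "moment_norm M m (\<lambda>x. \<Sum>j=1..p. X j x * u j) \<le> ennreal (sqrt (2 * m)) * ennreal \<mu>"
    if V0: "\<forall>j\<in>{1..p}. V j \<in> borel_measurable (F 0)" and u: "L2_set u {1..p} = 1" for u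
  proof (rule moment_norm_le_mult)
    interpret subgaussian_differences M p F X V u by (rule diffs)
    fix c assume c: "c > \<mu>"
    \<comment> \<open>The regularisation is chosen so that e^(m/2) fills exactly the gap between
      \<mu>^m and c^m; the two terms of the moment estimate then add up to c^m.\<close>
    define e where "e = (c powr m - \<mu> powr m) powr (2 / m)"
    have pos: "c powr m - \<mu> powr m > 0"
      using powr_less_mono2[of m \<mu> c] c \<mu>(1) assms(5) by simp
    then have e: "e > 0" "e powr (m / 2) = c powr m - \<mu> powr m"
      using assms(5) by (simp_all add: e_def powr_powr)
    have W2: "W2 p \<in> borel_measurable (F 0)"
      unfolding W2_def[abs_def] using V0
      by (intro borel_measurable_sum borel_measurable_power borel_measurable_times borel_measurable_const) auto
    have "(\<integral>\<^sup>+ x. ennreal (\<bar>S p x\<bar> powr m) \<partial>M)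
        \<le> ennreal ((2 * m) powr (m / 2)) *
            ((\<integral>\<^sup>+ x. ennreal (W2 p x powr (m / 2)) \<partial>M) + ennreal (e powr (m / 2)))"
      using assms(5) by (intro nn_integral_S_powr_le W2 e) auto
    also have "\<dots> \<le> ennreal ((2 * m) powr (m / 2)) * (ennreal (\<mu> powr m) + ennreal (e powr (m / 2)))"
      using assms(5) by (intro mult_left_mono add_mono nn_integral_W2_powr_le[OF u] V) auto
    also have "\<dots> = ennreal ((sqrt (2 * m) * c) powr m)"
    proof -
      have "(sqrt (2 * m) * c) powr m = (2 * m) powr (m / 2) * c powr m"
        using c \<mu>(1) assms(5) by (simp add: powr_mult powr_powr flip: powr_half_sqrt)
      then show ?thesis using pos e by (simp flip: ennreal_plus ennreal_mult)
    qed
    finally show "(\<integral>\<^sup>+ x. ennreal (\<bar>\<Sum>j=1..p. X j x * u j\<bar> powr m) \<partial>M) \<le> ennreal ((sqrt (2 * m) * c) powr m)"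
      by (simp add: S_def)
  qed (use assms(5) \<mu> in auto)
  moreover have "moment_norm M n (\<lambda>x. \<Sum>j=1..p. X j x * u j)
      \<le> ennreal (sqrt (2 * m / (m - n)) * (3 * m * Gamma (n / 2 + 1) / (m - n)) powr (1 / n)) * ennreal \<mu>"
    if n: "2 < n \<and> n < m" and u: "L2_set u {1..p} = 1" for n and u :: "nat \<Rightarrow> real"
  proof (rule moment_norm_le_mult)
    interpret subgaussian_differences M p F X V u by (rule diffs)
    fix c assume c: "c > \<mu>"
    have "(\<integral>\<^sup>+ x. ennreal (W2 p x powr (m / 2)) \<partial>M) \<le> ennreal (\<mu> powr m)"
      using assms(5) by (intro nn_integral_W2_powr_le[OF u] V) auto
    \<comment> \<open>Enlarging \<mu> to c provides the strictly positive constant that the tail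
      estimate divides by.\<close>
    also have "\<dots> \<le> ennreal (c powr m)"
      using c \<mu>(1) assms(5) by (intro ennreal_leI powr_mono2) auto
    finally show "(\<integral>\<^sup>+ x. ennreal (\<bar>\<Sum>j=1..p. X j x * u j\<bar> powr n) \<partial>M)
        \<le> ennreal ((sqrt (2 * m / (m - n)) * (3 * m * Gamma (n / 2 + 1) / (m - n)) powr (1 / n) * c) powr n)"
      using nn_integral_S_powr_le_predictable[of m c n] n c \<mu>(1) by (simp add: S_def)
  next
    have "Gamma (n / 2 + 1) > 0" using n by (intro Gamma_real_pos) auto
    then have "3 * m * Gamma (n / 2 + 1) / (m - n) > 0"
      using n by simp
    then show "sqrt (2 * m / (m - n)) * (3 * m * Gamma (n / 2 + 1) / (m - n)) powr (1 / n) > 0"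
      using n by (intro mult_pos_pos) (simp, unfold powr_gt_zero, rule less_imp_neq[symmetric])
  qed (use n \<mu> in auto)
  ultimately show ?thesis by (simp add: \<mu>(2))
qed

end
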